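(* Let $n,k,t,b,\lambda$ be positive integers with $t\le k\le n$. Let $\mathbb{D}=(\mathcal{P},\mathcal{B})$ be an incidence structure with point set $\mathcal{P}=\{1,2,\ldots,n\}$ and block set $\mathcal{B}=\{B_1,B_2,\ldots,B_b\}$, consisting of $b$ distinct $k$-subsets of $\mathcal{P}$. Then $\mathbb{D}$ is a $t$-$(n,k,\lambda)$ design if and only if for each integer $h$ with $0\le h\le t$, $$\hat f_{\mathbb{D}}(w)=\frac{\lambda\sum_{i=0}^{h}(-1)^i\binom{h}{i}\binom{n-h}{k-i}}{\binom{n-t}{k-t}}=\frac{\lambda P_k(h)}{\binom{n-t}{k-t}}$$ for all $w\in \mathrm{GF}(2)^n$ with $\mathrm{wt}(w)=h$.
   Context: $(\mathcal{P},\mathcal{B})$ is a $t$-$(n,k,\lambda)$ design if every $t$-subset of $\mathcal{P}$ is contained in exactly $\lambda$ elements of $\mathcal{B}$ (blocks are pairwise distinct). The support of $x\in \mathrm{GF}(2)^n$ is $\{i: x_i=1\}$, and $\mathrm{wt}(x)$ is its cardinality. The characteristic function $f_{\mathbb{D}}:\mathrm{GF}(2)^n\to\{0,1\}\subset\mathbb{R}$ has $f_{\mathbb{D}}(x)=1$ if and only if the support of $x$ is a block of $\mathcal{B}$. For $f:\mathrm{GF}(2)^n\to\{0,1\}$, the Walsh transform is $\hat f(w)=\sum_{x\in \mathrm{GF}(2)^n}f(x)(-1)^{w\cdot x}$, where $w\cdot x=\sum_i w_ix_i$. The Krawtchouk polynomial is $P_k(x)=\sum_{j=0}^{k}(-1)^j\binom{x}{j}\binom{n-x}{k-j}$.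 *)

theory Defs
  imports Complex_Main "HOL-Library.FuncSet" "HOL-Library.Z2"
begin

definition is_design ::
  "nat \<Rightarrow> nat \<Rightarrow> nat \<Rightarrow> nat \<Rightarrow> 'a set \<Rightarrow> 'a set set \<Rightarrow> bool" where
  "is_design t n k lam P \<B> \<longleftrightarrow>
     finite P \<and> card P = n \<and>
     (\<forall>B\<in>\<B>. B \<subseteq> P \<and> card B = k) \<and>
     (\<forall>T. T \<subseteq> P \<and> card T = t \<longrightarrow> card {B \<in> \<B>. T \<subseteq> B} = lam)"

text \<open>
  Vectors over GF(2) of length \<open>n\<close> are indexed by the point set \<open>{1..n}\<close>. They are
  extensional functions, so that there are exactly \<open>2 ^ n\<close> of them.
\<close>

definition gf2_space :: "nat \<Rightarrow> (nat \<Rightarrow> bit) set" where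
  "gf2_space n = {1..n} \<rightarrow>\<^sub>E (UNIV :: bit set)"

definition support :: "nat \<Rightarrow> (nat \<Rightarrow> bit) \<Rightarrow> nat set" where
  "support n x = {i \<in> {1..n}. x i = 1}"

definition wt :: "nat \<Rightarrow> (nat \<Rightarrow> bit) \<Rightarrow> nat" where
  "wt n x = card (support n x)"

definition dot :: "nat \<Rightarrow> (nat \<Rightarrow> bit) \<Rightarrow> (nat \<Rightarrow> bit) \<Rightarrow> bit" where
  "dot n w x = (\<Sum>i=1..n. w i * x i)"

definition char_fun :: "nat \<Rightarrow> nat set set \<Rightarrow> (nat \<Rightarrow> bit) \<Rightarrow> real" where
  "char_fun n \<B> x = (if support n x \<in> \<B> then 1 else 0)"

text \<open>The exponent is the representative in \<open>{0, 1}\<close> of the GF(2)-valued dot product.\<close>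

definition walsh :: "nat \<Rightarrow> ((nat \<Rightarrow> bit) \<Rightarrow> real) \<Rightarrow> (nat \<Rightarrow> bit) \<Rightarrow> real" where
  "walsh n f w = (\<Sum>x\<in>gf2_space n. f x * (- 1) ^ (of_bit (dot n w x) :: nat))"

definition krawtchouk :: "nat \<Rightarrow> nat \<Rightarrow> real \<Rightarrow> real" where
  "krawtchouk n k x =
     (\<Sum>j=0..k. (- 1) ^ j * (x gchoose j) * ((real n - x) gchoose (k - j)))"

end

theory Submission
  imports Defs
begin

text \<open>
  The idea is to compare \<open>\<B>\<close> with the complete design, whose blocks are all \<open>k\<close>-subsets of
  the \<open>n\<close> points. Give each \<open>k\<close>-subset \<open>B\<close> the weight \<open>g B = [B \<in> \<B>] - c\<close>, where
  \<open>c = \<lambda> / ((n - t) choose (k - t))\<close>. In the complete design a \<open>t\<close>-subset lies in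
  \<open>(n - t) choose (k - t)\<close> blocks, so \<open>\<B>\<close> is a \<open>t\<close>-design with parameter \<open>\<lambda>\<close> iff the cover
  sums \<open>N T = (\<Sum>B \<supseteq> T. g B)\<close> vanish for all \<open>T\<close> of size \<open>t\<close>. The Walsh transform of the
  complete design at a vector of weight \<open>h\<close> is \<open>P\<^sub>k(h)\<close>, so the Walsh condition says that the
  sign sums \<open>S W = (\<Sum>B. g B * (- 1) ^ card (W \<inter> B))\<close> vanish for all \<open>W\<close> of size at most
  \<open>t\<close>. Both conditions are thus homogeneous and linear in \<open>g\<close>, and their equivalence
  (\<open>cover_sum_eq_0_iff_sign_sum_eq_0\<close>) holds for every weight on a finite family of
  \<open>k\<close>-subsets.

  Two facts give this equivalence. First, expanding \<open>(- 1) ^ m = (1 + (- 2)) ^ m\<close> gives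
  \<open>S W = (\<Sum>T \<subseteq> W. (- 2) ^ card T * N T)\<close> (\<open>sign_sum_eq_cover_sums\<close>), a system that is
  triangular for inclusion with nonzero diagonal. Hence \<open>S\<close> vanishes up to size \<open>t\<close> iff \<open>N\<close>
  does. Second, if \<open>N\<close> vanishes at size \<open>t\<close>, then it vanishes at all smaller sizes, by double
  counting the pairs of a block and a further point in it (\<open>sum_cover_sum_insert\<close>).
\<close>

section \<open>Cover sums and sign sums of a weighted set family\<close>

definition cover_sum :: "'a set set \<Rightarrow> ('a set \<Rightarrow> real) \<Rightarrow> 'a set \<Rightarrow> real" where
  "cover_sum F g T = (\<Sum>B | B \<in> F \<and> T \<subseteq> B. g B)"

definition sign_sum :: "'a set set \<Rightarrow> ('a set \<Rightarrow> real) \<Rightarrow> 'a set \<Rightarrow> real" where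
  "sign_sum F g W = (\<Sum>B\<in>F. g B * (- 1) ^ card (W \<inter> B))"

lemma cover_sum_eq_sum_of_bool:
  assumes "finite F"
  shows "cover_sum F g T = (\<Sum>B\<in>F. g B * of_bool (T \<subseteq> B))"
  unfolding cover_sum_def using assms
  by (intro sum.mono_neutral_cong_left) auto

lemma sum_Pow_power_card:
  fixes a :: "'b::comm_ring_1"
  assumes "finite A"
  shows "(\<Sum>T\<in>Pow A. a ^ card T) = (1 + a) ^ card A"
  using assms
proof (induction A rule: finite_induct)
  case (insert x A)
  have "(\<Sum>T\<in>Pow (insert x A). a ^ card T)
      = (\<Sum>T\<in>Pow A. a ^ card T) + (\<Sum>T\<in>insert x ` Pow A. a ^ card T)"
    using insert.hyps unfolding Pow_insert by (intro sum.union_disjoint) auto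
  also have "(\<Sum>T\<in>insert x ` Pow A. a ^ card T) = (\<Sum>T\<in>Pow A. a ^ card (insert x T))"
  proof (subst sum.reindex)
    show "inj_on (insert x) (Pow A)"
      using insert.hyps(2) by (intro inj_onI) (metis PowD insert_ident subsetD)
  qed simp
  also have "\<dots> = (\<Sum>T\<in>Pow A. a * a ^ card T)"
  proof (rule sum.cong)
    fix T assume "T \<in> Pow A"
    hence "finite T" "x \<notin> T"
      using insert.hyps by (auto intro: finite_subset)
    thus "a ^ card (insert x T) = a * a ^ card T" by simp
  qed simp
  also have "(\<Sum>T\<in>Pow A. a ^ card T) + (\<Sum>T\<in>Pow A. a * a ^ card T) = (1 + a) ^ card (insert x A)"
    using insert by (simp add: sum_distrib_left[symmetric] algebra_simps)
  finally show ?case .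
qed simp

text \<open>
  The sign of a block is \<open>(1 + (- 2)) ^ card (W \<inter> B)\<close>, which is a sum over the subsets of
  \<open>W \<inter> B\<close>, that is, over the \<open>T \<subseteq> W\<close> which \<open>B\<close> covers.
\<close>

lemma sign_sum_eq_cover_sums:
  assumes "finite F" "finite W"
  shows "sign_sum F g W = (\<Sum>T\<in>Pow W. (- 2) ^ card T * cover_sum F g T)"
proof -
  have sign: "(- 1) ^ card (W \<inter> B) = (\<Sum>T\<in>Pow W. (- 2) ^ card T * of_bool (T \<subseteq> B) :: real)" for B
  proof -
    have "(- 1) ^ card (W \<inter> B) = (\<Sum>T\<in>Pow (W \<inter> B). (- 2 :: real) ^ card T)"
      using sum_Pow_power_card[of "W \<inter> B" "- 2 :: real"] assms by simp
    also have "\<dots> = (\<Sum>T\<in>Pow W. (- 2) ^ card T * of_bool (T \<subseteq> B))"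
      using assms by (intro sum.mono_neutral_cong_left) auto
    finally show ?thesis .
  qed
  have "sign_sum F g W = (\<Sum>B\<in>F. \<Sum>T\<in>Pow W. (- 2) ^ card T * (g B * of_bool (T \<subseteq> B)))"
    unfolding sign_sum_def sign by (simp add: sum_distrib_left mult_ac)
  also have "\<dots> = (\<Sum>T\<in>Pow W. \<Sum>B\<in>F. (- 2) ^ card T * (g B * of_bool (T \<subseteq> B)))"
    by (rule sum.swap)
  also have "\<dots> = (\<Sum>T\<in>Pow W. (- 2) ^ card T * cover_sum F g T)"
    by (simp only: cover_sum_eq_sum_of_bool[OF assms(1)] sum_distrib_left)
  finally show ?thesis .
qed

text \<open>
  A block of size \<open>k\<close> that covers \<open>R\<close> contributes to the left-hand side once for each of its
  \<open>k - card R\<close> points outside \<open>R\<close>.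
\<close>

lemma sum_cover_sum_insert:
  assumes "finite P" "R \<subseteq> P" and F: "\<And>B. B \<in> F \<Longrightarrow> B \<subseteq> P \<and> card B = k"
  shows "(\<Sum>x\<in>P - R. cover_sum F g (insert x R)) = real (k - card R) * cover_sum F g R"
proof -
  have finF: "finite F"
    using F assms(1) by (intro finite_subset[of F "Pow P"]) auto
  have count: "(\<Sum>x\<in>P - R. of_bool (insert x R \<subseteq> B)) = (real (k - card R) * of_bool (R \<subseteq> B) :: real)"
    if "B \<in> F" for B
  proof (cases "R \<subseteq> B")
    case True
    have "(\<Sum>x\<in>P - R. of_bool (insert x R \<subseteq> B)) = (\<Sum>x\<in>B - R. 1 :: real)"
      using True F[OF that] assms(1) by (intro sum.mono_neutral_cong_right) auto
    also have "\<dots> = real (k - card R)"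
      using True F[OF that] card_Diff_subset[of R B] finite_subset[OF assms(2,1)] by simp
    finally show ?thesis using True by simp
  qed simp
  have "(\<Sum>x\<in>P - R. cover_sum F g (insert x R))
      = (\<Sum>x\<in>P - R. \<Sum>B\<in>F. g B * of_bool (insert x R \<subseteq> B))"
    by (simp only: cover_sum_eq_sum_of_bool[OF finF])
  also have "\<dots> = (\<Sum>B\<in>F. g B * (\<Sum>x\<in>P - R. of_bool (insert x R \<subseteq> B)))"
    by (subst sum.swap) (simp only: sum_distrib_left)
  also have "\<dots> = (\<Sum>B\<in>F. real (k - card R) * (g B * of_bool (R \<subseteq> B)))"
    by (intro sum.cong refl) (simp only: count mult_ac)
  also have "\<dots> = real (k - card R) * cover_sum F g R"
    by (simp only: cover_sum_eq_sum_of_bool[OF finF] sum_distrib_left)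
  finally show ?thesis .
qed

text \<open>
  Below size \<open>t \<le> k\<close> the factor \<open>k - card R\<close> of the double count is positive, so vanishing
  passes from the sets \<open>insert x R\<close> to \<open>R\<close>.
\<close>

lemma cover_sum_eq_0_descend:
  assumes "finite P" "t \<le> k" and F: "\<And>B. B \<in> F \<Longrightarrow> B \<subseteq> P \<and> card B = k"
    and t: "\<And>T. T \<subseteq> P \<Longrightarrow> card T = t \<Longrightarrow> cover_sum F g T = 0"
    and R: "R \<subseteq> P" "card R \<le> t"
  shows "cover_sum F g R = 0"
  using R
proof (induction "t - card R" arbitrary: R)
  case 0
  thus ?case using t by simp
next
  case (Suc m)
  have "cover_sum F g (insert x R) = 0" if "x \<in> P - R" for x
  proof -
    have "card (insert x R) = Suc (card R)"
      using that Suc.prems assms(1) by (simp add: finite_subset)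
    thus ?thesis using Suc that by auto
  qed
  hence "real (k - card R) * cover_sum F g R = 0"
    using sum_cover_sum_insert[of P R F k g] assms(1) F Suc.prems by simp
  moreover have "card R < k" using Suc.hyps(2) \<open>t \<le> k\<close> by linarith
  ultimately show ?case by simp
qed

theorem cover_sum_eq_0_iff_sign_sum_eq_0:
  assumes "finite P" "t \<le> k" and F: "\<And>B. B \<in> F \<Longrightarrow> B \<subseteq> P \<and> card B = k"
  shows "(\<forall>T. T \<subseteq> P \<and> card T = t \<longrightarrow> cover_sum F g T = 0) \<longleftrightarrow>
         (\<forall>W. W \<subseteq> P \<and> card W \<le> t \<longrightarrow> sign_sum F g W = 0)"
proof -
  have finF: "finite F"
    using F assms(1) by (intro finite_subset[of F "Pow P"]) auto
  show ?thesis
  proof (intro iffI allI impI)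
    fix W
    assume T: "\<forall>T. T \<subseteq> P \<and> card T = t \<longrightarrow> cover_sum F g T = 0" and W: "W \<subseteq> P \<and> card W \<le> t"
    have finW: "finite W" using W assms(1) finite_subset by blast
    have "cover_sum F g T = 0" if "T \<in> Pow W" for T
    proof (rule cover_sum_eq_0_descend[OF assms])
      show "T \<subseteq> P" using that W by auto
      show "card T \<le> t" using that W card_mono[OF finW, of T] by auto
    qed (use T in auto)
    thus "sign_sum F g W = 0"
      by (simp add: sign_sum_eq_cover_sums[OF finF finW])
  next
    fix T
    assume S: "\<forall>W. W \<subseteq> P \<and> card W \<le> t \<longrightarrow> sign_sum F g W = 0" and "T \<subseteq> P \<and> card T = t"
    moreover have "cover_sum F g R = 0" if "R \<subseteq> P" "card R \<le> t" for R
      using finite_subset[OF that(1) assms(1)] that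
    proof (induction R rule: finite_psubset_induct)
      case (psubset R)
      have "cover_sum F g Q = 0" if "Q \<in> Pow R - {R}" for Q
      proof -
        have "Q \<subset> R" using that by auto
        thus ?thesis
          using psubset.IH[of Q] psubset.prems psubset_card_mono[OF psubset.hyps, of Q] by auto
      qed
      hence "sign_sum F g R = (- 2) ^ card R * cover_sum F g R"
        using psubset.hyps
        by (simp add: sign_sum_eq_cover_sums[OF finF] sum.remove[where x = R])
      thus ?case using S psubset.prems by simp
    qed
    ultimately show "cover_sum F g T = 0" by simp
  qed
qed

section \<open>The complete design\<close>

text \<open>A \<open>k\<close>-subset amounts to independent choices of its parts inside and outside \<open>W\<close>.\<close>

lemma card_subsets_with_card_Int:
  assumes "finite P" "W \<subseteq> P" "i \<le> k"
  shows "card {B. B \<subseteq> P \<and> card B = k \<and> card (W \<inter> B) = i}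
       = (card W choose i) * ((card P - card W) choose (k - i))"
proof -
  have fin: "finite W" "finite (P - W)"
    using assms finite_subset by auto
  let ?X = "{C. C \<subseteq> W \<and> card C = i} \<times> {D. D \<subseteq> P - W \<and> card D = k - i}"
  have card_Un: "card (W \<inter> B) + card (B - W) = card B" if "B \<subseteq> P" for B
    using card_Int_Diff[of B W] that assms(1) finite_subset[of B P] by (simp add: Int_commute)
  have "bij_betw (\<lambda>B. (W \<inter> B, B - W)) {B. B \<subseteq> P \<and> card B = k \<and> card (W \<inter> B) = i} ?X"
  proof (rule bij_betw_byWitness[where f' = "\<lambda>(C, D). C \<union> D"])
    show "(\<lambda>B. (W \<inter> B, B - W)) ` {B. B \<subseteq> P \<and> card B = k \<and> card (W \<inter> B) = i} \<subseteq> ?X"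
    proof clarsimp
      fix B assume "B \<subseteq> P" "k = card B" "i = card (W \<inter> B)"
      thus "B - W \<subseteq> P - W \<and> card (B - W) = card B - card (W \<inter> B)"
        using card_Un[of B] by auto
    qed
    show "(\<lambda>(C, D). C \<union> D) ` ?X \<subseteq> {B. B \<subseteq> P \<and> card B = k \<and> card (W \<inter> B) = i}"
    proof clarsimp
      fix C D assume CD: "C \<subseteq> W" "D \<subseteq> P - W" "i = card C" "card D = k - card C"
      have eq: "W \<inter> (C \<union> D) = C" "C \<union> D - W = D" using CD by auto
      have sub: "C \<union> D \<subseteq> P" using CD assms(2) by auto
      show "C \<subseteq> P \<and> D \<subseteq> P \<and> card (C \<union> D) = k \<and> card (W \<inter> (C \<union> D)) = card C"
        using card_Un[OF sub] CD assms(3) sub unfolding eq by auto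
    qed
  qed auto
  hence "card {B. B \<subseteq> P \<and> card B = k \<and> card (W \<inter> B) = i} = card ?X"
    by (rule bij_betw_same_card)
  also have "\<dots> = (card W choose i) * ((card P - card W) choose (k - i))"
    using fin assms finite_subset[of W P]
    by (simp add: card_cartesian_product n_subsets card_Diff_subset)
  finally show ?thesis .
qed

text \<open>The blocks that cover \<open>T\<close> are those that meet it in all of its points.\<close>

lemma card_supersets:
  assumes "finite P" "T \<subseteq> P" "card T \<le> k"
  shows "card {B. B \<subseteq> P \<and> card B = k \<and> T \<subseteq> B} = (card P - card T) choose (k - card T)"
proof -
  have "T \<subseteq> B \<longleftrightarrow> card (T \<inter> B) = card T" for B
    using card_subset_eq[of T "T \<inter> B"] finite_subset[OF assms(2,1)] by (auto simp: Int_absorb2)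
  thus ?thesis
    using card_subsets_with_card_Int[OF assms] by simp
qed

lemma sign_sum_complete_design:
  assumes "finite P" "W \<subseteq> P" "card W \<le> k"
  shows "sign_sum {B. B \<subseteq> P \<and> card B = k} (\<lambda>_. 1) W
       = (\<Sum>i=0..card W. (- 1) ^ i * real (card W choose i) * real ((card P - card W) choose (k - i)))"
proof -
  let ?K = "{B. B \<subseteq> P \<and> card B = k}"
  have finW: "finite W" using assms finite_subset by blast
  have "sign_sum ?K (\<lambda>_. 1) W
      = (\<Sum>i\<in>{0..card W}. \<Sum>B | B \<in> ?K \<and> card (W \<inter> B) = i. (- 1) ^ card (W \<inter> B))"
    unfolding sign_sum_def
    using assms card_mono[OF finW, of "W \<inter> _"] by (subst sum.group) auto
  also have "\<dots> = (\<Sum>i=0..card W. (- 1) ^ i * real (card W choose i) * real ((card P - card W) choose (k - i)))"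
    using assms by (intro sum.cong refl) (simp add: card_subsets_with_card_Int conj_assoc)
  finally show ?thesis .
qed

text \<open>The terms with \<open>h < j \<le> k\<close> vanish because \<open>h choose j = 0\<close>.\<close>

lemma krawtchouk_of_nat:
  assumes "h \<le> k" "h \<le> n"
  shows "krawtchouk n k (real h)
       = (\<Sum>i=0..h. (- 1) ^ i * real (h choose i) * real ((n - h) choose (k - i)))"
  unfolding krawtchouk_def of_nat_diff[OF assms(2), symmetric] binomial_gbinomial[symmetric]
  using assms by (intro sum.mono_neutral_right) auto

section \<open>Walsh transforms as sign sums\<close>

lemma support_subset: "support n w \<subseteq> {1..n}"
  by (auto simp: support_def)

lemma bij_betw_support: "bij_betw (support n) (gf2_space n) (Pow {1..n})"
proof (rule bij_betw_byWitness[where f' = "\<lambda>A. \<lambda>i\<in>{1..n}. of_bool (i \<in> A)"])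
  show "\<forall>x\<in>gf2_space n. (\<lambda>i\<in>{1..n}. of_bool (i \<in> support n x)) = x"
  proof
    fix x assume x: "x \<in> gf2_space n"
    show "(\<lambda>i\<in>{1..n}. of_bool (i \<in> support n x)) = x"
    proof (rule extensionalityI[of _ "{1..n}"])
      show "x \<in> extensional {1..n}" using x by (auto simp: gf2_space_def PiE_iff)
      show "(\<lambda>i\<in>{1..n}. of_bool (i \<in> support n x)) i = x i" if "i \<in> {1..n}" for i
        using that by (cases "x i") (auto simp: support_def)
    qed simp
  qed
qed (auto simp: gf2_space_def support_def)

text \<open>Addition in GF(2) turns into multiplication of signs, because \<open>a \<mapsto> (- 1) ^ a\<close> is a character.\<close>

lemma sign_dot: "(- 1 :: real) ^ (of_bit (dot n w x) :: nat) = (- 1) ^ card (support n w \<inter> support n x)"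
proof -
  have character: "(- 1 :: real) ^ (of_bit (sum f A) :: nat) = (\<Prod>i\<in>A. if f i = 1 then - 1 else 1)"
    if "finite A" for f :: "nat \<Rightarrow> bit" and A
    using that
  proof (induction A rule: finite_induct)
    case (insert a A)
    have "(- 1 :: real) ^ (of_bit (u + v) :: nat) = (if u = 1 then - 1 else 1) * (- 1) ^ (of_bit v :: nat)"
      for u v :: bit
      by (cases u; cases v) auto
    thus ?case using insert by simp
  qed simp
  have "(- 1 :: real) ^ (of_bit (dot n w x) :: nat) = (\<Prod>i\<in>{1..n}. if w i * x i = 1 then - 1 else 1)"
    unfolding dot_def by (rule character) simp
  also have "\<dots> = (\<Prod>i\<in>support n w \<inter> support n x. - 1)"
    by (rule prod.mono_neutral_cong_right) (auto simp: support_def)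
  finally show ?thesis by simp
qed

lemma walsh_char_fun_eq_sign_sum:
  assumes "F \<subseteq> Pow {1..n}" "\<B> \<subseteq> F"
  shows "walsh n (char_fun n \<B>) w = sign_sum F (\<lambda>B. of_bool (B \<in> \<B>)) (support n w)"
proof -
  have "walsh n (char_fun n \<B>) w
      = (\<Sum>x\<in>gf2_space n. of_bool (support n x \<in> \<B>) * (- 1) ^ card (support n w \<inter> support n x))"
    unfolding walsh_def sign_dot by (simp add: char_fun_def of_bool_def)
  also have "\<dots> = (\<Sum>B\<in>Pow {1..n}. of_bool (B \<in> \<B>) * (- 1) ^ card (support n w \<inter> B))"
    by (rule sum.reindex_bij_betw[OF bij_betw_support])
  also have "\<dots> = sign_sum F (\<lambda>B. of_bool (B \<in> \<B>)) (support n w)"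
    unfolding sign_sum_def using assms by (intro sum.mono_neutral_right) auto
  finally show ?thesis .
qed

section \<open>Designs and their Walsh transforms\<close>

theorem theorem13:
  fixes n k t b lam :: nat and \<B> :: "nat set set"
  assumes "0 < n" and "0 < k" and "0 < t" and "0 < b" and "0 < lam"
    and "t \<le> k" and "k \<le> n"
    and "card \<B> = b"
    and "\<And>B. B \<in> \<B> \<Longrightarrow> B \<subseteq> {1..n} \<and> card B = k"
  shows "is_design t n k lam {1..n} \<B> \<longleftrightarrow>
    (\<forall>h. 0 \<le> h \<and> h \<le> t \<longrightarrow>
      (\<forall>w \<in> gf2_space n. wt n w = h \<longrightarrow>
        walsh n (char_fun n \<B>) w
          = real lam * (\<Sum>i=0..h. (- 1) ^ i * real (h choose i) * real ((n - h) choose (k - i)))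
              / real ((n - t) choose (k - t)) \<and>
        real lam * (\<Sum>i=0..h. (- 1) ^ i * real (h choose i) * real ((n - h) choose (k - i)))
              / real ((n - t) choose (k - t))
          = real lam * krawtchouk n k (real h) / real ((n - t) choose (k - t))))"
proof -
  define K where "K = {B. B \<subseteq> {1..n} \<and> card B = k}"
  define c where "c = real lam / real ((n - t) choose (k - t))"
  define g where "g B = of_bool (B \<in> \<B>) - c" for B
  define Pk where "Pk h = (\<Sum>i=0..h. (- 1) ^ i * real (h choose i) * real ((n - h) choose (k - i)))" for h
  have K: "B \<subseteq> {1..n} \<and> card B = k" if "B \<in> K" for B
    using that by (simp add: K_def)
  have KPow: "K \<subseteq> Pow {1..n}" and \<B>K: "\<B> \<subseteq> K"
    using K assms(9) by (auto simp: K_def)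
  have finK: "finite K" by (rule finite_subset[OF KPow]) simp
  have cover: "cover_sum K g T = real (card {B \<in> \<B>. T \<subseteq> B}) - real lam"
    if T: "T \<subseteq> {1..n}" "card T = t" for T
  proof -
    have "cover_sum K g T
        = (\<Sum>B | B \<in> K \<and> T \<subseteq> B. of_bool (B \<in> \<B>)) - c * real (card {B. B \<in> K \<and> T \<subseteq> B})"
      by (simp add: cover_sum_def g_def sum_subtractf)
    also have "(\<Sum>B | B \<in> K \<and> T \<subseteq> B. of_bool (B \<in> \<B>)) = (\<Sum>B | B \<in> \<B> \<and> T \<subseteq> B. 1 :: real)"
      using finK \<B>K by (intro sum.mono_neutral_cong_right) auto
    also have "card {B. B \<in> K \<and> T \<subseteq> B} = (n - t) choose (k - t)"
      using card_supersets[of "{1..n}" T k] T assms(6) by (simp add: K_def conj_assoc)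
    also have "c * real ((n - t) choose (k - t)) = real lam"
      using assms(6,7) by (simp add: c_def)
    finally show ?thesis by simp
  qed
  have design: "is_design t n k lam {1..n} \<B> \<longleftrightarrow>
      (\<forall>T. T \<subseteq> {1..n} \<and> card T = t \<longrightarrow> cover_sum K g T = 0)"
    using assms(9) by (auto simp: is_design_def cover)
  have walsh: "sign_sum K g (support n w) = walsh n (char_fun n \<B>) w - c * Pk (wt n w)"
    if "wt n w \<le> t" for w
  proof -
    have "sign_sum K g (support n w)
        = walsh n (char_fun n \<B>) w - c * sign_sum K (\<lambda>_. 1) (support n w)"
      unfolding walsh_char_fun_eq_sign_sum[OF KPow \<B>K]
      by (simp add: sign_sum_def g_def left_diff_distrib sum_subtractf sum_distrib_left)
    also have "sign_sum K (\<lambda>_. 1) (support n w) = Pk (wt n w)"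
      using sign_sum_complete_design[OF _ support_subset, of n w k] that assms(6)
      by (simp add: K_def Pk_def wt_def)
    finally show ?thesis .
  qed
  have "(\<forall>W. W \<subseteq> {1..n} \<and> card W \<le> t \<longrightarrow> sign_sum K g W = 0) \<longleftrightarrow>
      (\<forall>W\<in>support n ` gf2_space n. card W \<le> t \<longrightarrow> sign_sum K g W = 0)"
    unfolding bij_betw_imp_surj_on[OF bij_betw_support] by auto
  also have "\<dots> \<longleftrightarrow> (\<forall>w\<in>gf2_space n. wt n w \<le> t \<longrightarrow> walsh n (char_fun n \<B>) w = c * Pk (wt n w))"
    using walsh by (auto simp: wt_def)
  finally have "is_design t n k lam {1..n} \<B> \<longleftrightarrow>
      (\<forall>w\<in>gf2_space n. wt n w \<le> t \<longrightarrow> walsh n (char_fun n \<B>) w = c * Pk (wt n w))"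
    unfolding design using cover_sum_eq_0_iff_sign_sum_eq_0[of "{1..n}" t k K g] assms(6) K by simp
  moreover have "krawtchouk n k (real h) = Pk h" if "h \<le> t" for h
    using krawtchouk_of_nat[of h k n] that assms(6,7) by (simp add: Pk_def)
  ultimately show ?thesis
    unfolding Pk_def[symmetric] by (auto simp: c_def)
qed

end
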